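(* For every complex number $a$ with $2a+\tfrac12\notin\{0,-1,-2,\dots\}$, $$F_1\left(2a;\,1-3a,\,4a-1;\,2a+\tfrac12;\,-\tfrac1{80},\tfrac5{32}\right)=\frac{2^{6a}}{5^{3a}}\,\frac{\sqrt\pi\,\Gamma(2a+1/2)}{\Gamma(a+1/2)^2}.$$
   Context: Appell's hypergeometric series is $F_1(\alpha;\beta_1,\beta_2;\gamma;x,y)=\sum_{m,n\ge0}\frac{(\alpha,m+n)(\beta_1,m)(\beta_2,n)}{(\gamma,m+n)(1,m)(1,n)}x^my^n$ for $\gamma\notin\{0,-1,-2,\dots\}$, absolutely convergent for $|x|<1$, $|y|<1$, where $(\alpha,n)=\alpha(\alpha+1)\cdots(\alpha+n-1)$, $(\alpha,0)=1$. For real $r>0$, $r^{a}=e^{a\log r}$ with real $\log r$. $1/\Gamma$ is the entire function (zero at the poles of $\Gamma$). *)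

theory Defs
  imports "HOL-Analysis.Analysis"
begin

text \<open>
  Appell's series, as an unordered sum over pairs \<open>(m, n)\<close>; for \<open>|x| < 1\<close>, \<open>|y| < 1\<close> it converges
  absolutely, so the order of summation is immaterial. The Pochhammer symbol \<open>(\<alpha>, n)\<close> is the
  library's \<^const>\<open>pochhammer\<close>. The value is only meaningful for \<open>\<gamma> \<notin> {0, -1, -2, \<dots>}\<close>.
\<close>

definition appell_F1 ::
  "complex \<Rightarrow> complex \<Rightarrow> complex \<Rightarrow> complex \<Rightarrow> complex \<Rightarrow> complex \<Rightarrow> complex" where
  "appell_F1 \<alpha> \<beta>\<^sub>1 \<beta>\<^sub>2 \<gamma> x y =
     (\<Sum>\<^sub>\<infinity>(m, n) \<in> (UNIV :: (nat \<times> nat) set).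
        pochhammer \<alpha> (m + n) * pochhammer \<beta>\<^sub>1 m * pochhammer \<beta>\<^sub>2 n /
        (pochhammer \<gamma> (m + n) * pochhammer 1 m * pochhammer 1 n) * x ^ m * y ^ n)"

end

theory Submission
  imports Defs "HOL-Complex_Analysis.Conformal_Mappings"
begin

text \<open>
  For real \<open>a > 1\<close>, Euler's integral expresses \<open>F\<^sub>1\<close> through the integral of \<open>u\<close> to the power \<open>a\<close>
  against an algebraic differential, where \<open>u = t\<^sup>2 (1 + t/80)\<^sup>3 / (1 - 5t/32)\<^sup>4\<close>. The differential is
  the pullback of \<open>dv / (2 v sqrt (1 - v))\<close> along the rational map \<open>v = 125 u / 256\<close>, so the integral is a
  Beta integral. Both sides are holomorphic in \<open>a\<close> off a countable closed set, whose complement is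
  connected, hence they agree everywhere.
\<close>

section \<open>Antidiagonal sums and binomial series\<close>

text \<open>In Appell's series the symbols of \<alpha> and \<gamma> depend only on
  \<open>m + n\<close>; grouping pairs by this sum leaves a single series with explicit
  coefficients.\<close>

lemma antidiagonal_sums:
  fixes f :: "nat \<times> nat \<Rightarrow> 'a::banach"
  assumes "f summable_on UNIV"
  shows "(\<lambda>k. \<Sum>i\<le>k. f (i, k - i)) sums infsum f UNIV"
proof -
  have "(f has_sum infsum f UNIV) UNIV"
    using assms by simp
  also have "?this \<longleftrightarrow> ((\<lambda>(k, i). f (i, k - i)) has_sum infsum f UNIV) (SIGMA k:UNIV. {..k})"
    by (rule has_sum_reindex_bij_witness[where j = "\<lambda>(m, n). (m + n, m)" and i = "\<lambda>(k, i). (i, k - i)"])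
       auto
  finally have "((\<lambda>k. \<Sum>i\<le>k. f (i, k - i)) has_sum infsum f UNIV) UNIV"
    by (rule has_sum_SigmaD) (auto intro: has_sum_finite)
  then show ?thesis
    by (rule has_sum_imp_sums)
qed

lemma norm_pochhammer_le:
  fixes z :: "'a::real_normed_field"
  assumes "norm z \<le> B"
  shows "norm (pochhammer z n) \<le> pochhammer B n"
proof -
  have "norm (pochhammer z n) = (\<Prod>i<n. norm (z + of_nat i))"
    by (simp add: pochhammer_prod prod_norm atLeast0LessThan)
  also have "\<dots> \<le> (\<Prod>i<n. B + real i)"
    by (intro prod_mono conjI norm_ge_zero order.trans[OF norm_triangle_ineq]) (use assms in auto)
  finally show ?thesis
    by (simp add: pochhammer_prod atLeast0LessThan)
qed

lemma pochhammer_sums_powr: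
  fixes \<beta> z :: real
  assumes "\<bar>z\<bar> < 1"
  shows "(\<lambda>n. pochhammer \<beta> n / fact n * z ^ n) sums (1 - z) powr (- \<beta>)"
proof -
  have "(\<lambda>n. (- \<beta> gchoose n) * (- z) ^ n) sums (1 + - z) powr (- \<beta>)"
    by (rule gen_binomial_real) (use assms in simp)
  moreover have "(- \<beta> gchoose n) * (- z) ^ n = pochhammer \<beta> n / fact n * z ^ n" for n
  proof -
    have "(- 1) ^ n * (- 1) ^ n = (1 :: real)"
      by (simp flip: power_mult_distrib)
    then show ?thesis
      by (simp only: gbinomial_pochhammer power_minus[of z n] minus_minus) (simp add: mult_ac)
  qed
  ultimately show ?thesis
    by simp
qed

text \<open>\<open>binomial_diag \<beta>\<^sub>1 \<beta>\<^sub>2 x y k\<close> is the coefficient of \<open>t\<^sup>k\<close> in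
  \<open>(1 - x t)\<close> to the power \<open>- \<beta>\<^sub>1\<close> times \<open>(1 - y t)\<close> to the power \<open>- \<beta>\<^sub>2\<close>.\<close>

definition binomial_diag :: "'a::real_normed_field \<Rightarrow> 'a \<Rightarrow> 'a \<Rightarrow> 'a \<Rightarrow> nat \<Rightarrow> 'a" where
  "binomial_diag \<beta>\<^sub>1 \<beta>\<^sub>2 x y k =
     (\<Sum>i\<le>k. (pochhammer \<beta>\<^sub>1 i / fact i * x ^ i) * (pochhammer \<beta>\<^sub>2 (k - i) / fact (k - i) * y ^ (k - i)))"

text \<open>Supplies majorants independent of the parameters for the Weierstrass tests;
  \<open>binomial_diag_sums\<close> makes them summable once both arguments are below 1.\<close>

lemma norm_binomial_diag_le:
  fixes \<beta>\<^sub>1 \<beta>\<^sub>2 x y :: "'a::real_normed_field"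
  assumes "norm \<beta>\<^sub>1 \<le> B" "norm \<beta>\<^sub>2 \<le> B"
  shows "norm (binomial_diag \<beta>\<^sub>1 \<beta>\<^sub>2 x y k) \<le> binomial_diag B B (norm x) (norm y) k"
proof -
  have "0 \<le> B"
    using assms(1) norm_ge_zero order.trans by blast
  then have "0 \<le> pochhammer B i" for i
    by (simp add: pochhammer_prod prod_nonneg)
  then show ?thesis
    unfolding binomial_diag_def
    by (intro sum_norm_le order.trans[OF norm_sum] sum_mono)
       (auto simp: norm_mult norm_divide norm_power intro!: mult_mono divide_right_mono norm_pochhammer_le assms)
qed

text \<open>Each summand is homogeneous of degree \<open>k\<close> in the two arguments. This
  absorbs a growth factor \<open>r ^ k\<close> into the arguments of a majorant, and extracts the
  \<open>k\<close>-th power of \<open>1 - s\<^sup>2\<close> in Euler's integral.\<close>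

lemma binomial_diag_scale:
  "binomial_diag \<beta>\<^sub>1 \<beta>\<^sub>2 (r * x) (r * y) k = r ^ k * binomial_diag \<beta>\<^sub>1 \<beta>\<^sub>2 x y k"
proof -
  have "(r * x) ^ i * (r * y) ^ (k - i) = r ^ k * (x ^ i * y ^ (k - i))" if "i \<le> k" for i
    using that by (simp add: power_mult_distrib mult_ac flip: power_add)
  then show ?thesis
    unfolding binomial_diag_def sum_distrib_left
    by (intro sum.cong) (auto simp: mult_ac)
qed

lemma binomial_diag_sums:
  fixes x y :: real
  assumes "\<bar>x\<bar> < 1" "\<bar>y\<bar> < 1"
  shows "binomial_diag \<beta>\<^sub>1 \<beta>\<^sub>2 x y sums ((1 - x) powr (- \<beta>\<^sub>1) * (1 - y) powr (- \<beta>\<^sub>2))"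
proof -
  have abs: "summable (\<lambda>n. norm (pochhammer \<beta> n / fact n * z ^ n))" if "\<bar>z\<bar> < 1" for \<beta> z :: real
  proof (rule summable_comparison_test')
    show "summable (\<lambda>n. pochhammer \<bar>\<beta>\<bar> n / fact n * \<bar>z\<bar> ^ n)"
      using pochhammer_sums_powr[of "\<bar>z\<bar>" "\<bar>\<beta>\<bar>"] that by (auto simp: sums_iff)
  qed (auto simp: abs_mult power_abs norm_pochhammer_le[where 'a = real, simplified] 
        intro!: mult_right_mono divide_right_mono)
  have "(\<lambda>k. binomial_diag \<beta>\<^sub>1 \<beta>\<^sub>2 x y k) sums
          ((\<Sum>n. pochhammer \<beta>\<^sub>1 n / fact n * x ^ n) * (\<Sum>n. pochhammer \<beta>\<^sub>2 n / fact n * y ^ n))"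
    unfolding binomial_diag_def by (intro Cauchy_product_sums abs assms)
  then show ?thesis
    by (simp only: sums_unique[OF pochhammer_sums_powr, symmetric] assms)
qed

section \<open>Convergence of Appell's series and holomorphy in its parameters\<close>

text \<open>Consecutive quotients differ by the factor
  \<open>(\<alpha> z + k) / (\<gamma> z + k)\<close>, which tends to 1 uniformly on
  \<open>C\<close>. Beyond some index it is at most \<open>r\<close> in norm, and compactness bounds
  the finitely many earlier quotients.\<close>

lemma pochhammer_quotient_bound:
  fixes \<alpha> \<gamma> :: "'b::topological_space \<Rightarrow> 'a::{real_normed_field, heine_borel}"
  assumes C: "compact C" "continuous_on C \<alpha>" "continuous_on C \<gamma>"
    and \<gamma>: "\<And>z. z \<in> C \<Longrightarrow> \<gamma> z \<notin> \<int>\<^sub>\<le>\<^sub>0" and "r > 1"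
  shows "\<exists>K\<ge>0. \<forall>z\<in>C. \<forall>k. norm (pochhammer (\<alpha> z) k / pochhammer (\<gamma> z) k) \<le> K * r ^ k"
proof -
  define q where "q k z = pochhammer (\<alpha> z) k / pochhammer (\<gamma> z) k" for k z
  have bdd: "\<exists>K. \<forall>z\<in>C. norm (g z) \<le> K" if "continuous_on C g" for g :: "'b \<Rightarrow> 'a"
    using compact_imp_bounded[OF compact_continuous_image[OF that C(1)]]
    by (auto simp: bounded_iff)
  obtain A where A: "norm (\<alpha> z - \<gamma> z) \<le> A" if "z \<in> C" for z
    using bdd[OF continuous_on_diff[OF C(2,3)]] by blast
  obtain M where M: "norm (\<gamma> z) \<le> M" if "z \<in> C" for z
    using bdd[of \<gamma>] C by blast
  have "continuous_on C (q k)" for k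
    using \<gamma> unfolding q_def pochhammer_prod
    by (intro continuous_intros C) (auto dest: plus_of_nat_eq_0_imp)
  then have "\<forall>k. \<exists>K. \<forall>z\<in>C. norm (q k z) \<le> K"
    using bdd by blast
  then obtain K where K: "norm (q k z) \<le> K k" if "z \<in> C" for k z
    by metis
  \<comment> \<open>For \<open>k \<ge> J\<close> this gives
    \<open>norm (\<gamma> z + k) \<ge> A / (r - 1)\<close>, so the difference of numerator and
    denominator, at most \<open>A\<close>, costs no more than a factor \<open>r\<close>.\<close>
  obtain J :: nat where J: "real J \<ge> M + A / (r - 1)"
    using real_arch_simple by blast
  have step: "norm (q (Suc k) z) \<le> r * norm (q k z)" if "z \<in> C" "k \<ge> J" for z k
  proof -
    have "A / (r - 1) \<le> real k - norm (\<gamma> z)"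
      using J M[OF that(1)] that(2) by linarith
    also have "\<dots> \<le> norm (\<gamma> z + of_nat k)"
      using norm_triangle_ineq2[of "of_nat k :: 'a" "- \<gamma> z"] by (simp add: add.commute)
    finally have "A \<le> (r - 1) * norm (\<gamma> z + of_nat k)"
      using \<open>r > 1\<close> by (simp add: field_simps)
    moreover have "norm (\<alpha> z + of_nat k) \<le> A + norm (\<gamma> z + of_nat k)"
      using norm_triangle_ineq[of "\<alpha> z - \<gamma> z" "\<gamma> z + of_nat k"] A[OF that(1)] by simp
    ultimately have "norm (\<alpha> z + of_nat k) \<le> r * norm (\<gamma> z + of_nat k)"
      by (simp add: algebra_simps)
    moreover have "\<gamma> z + of_nat k \<noteq> 0"
      using \<gamma>[OF that(1)] plus_of_nat_eq_0_imp by blast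
    ultimately have "norm ((\<alpha> z + of_nat k) / (\<gamma> z + of_nat k)) \<le> r"
      by (simp add: norm_divide field_simps)
    moreover have "q (Suc k) z = (\<alpha> z + of_nat k) / (\<gamma> z + of_nat k) * q k z"
      by (simp add: q_def pochhammer_Suc mult.commute)
    ultimately show ?thesis
      by (metis mult_right_mono norm_ge_zero norm_mult)
  qed
  \<comment> \<open>The sum dominates every \<open>K j\<close> with \<open>j \<le> J\<close>. The
    index \<open>J\<close> is included because \<open>Suc k\<close> may equal \<open>J\<close> when
    \<open>k < J\<close>.\<close>
  have bound: "norm (q k z) \<le> (\<Sum>j\<le>J. \<bar>K j\<bar>) * r ^ k" if "z \<in> C" for k z
  proof (induction k)
    case 0
    have "norm (q 0 z) \<le> \<bar>K 0\<bar>"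
      using K[OF that, of 0] by linarith
    also have "\<dots> \<le> (\<Sum>j\<le>J. \<bar>K j\<bar>)"
      by (rule member_le_sum) auto
    finally show ?case by simp
  next
    case (Suc k)
    show ?case
    proof (cases "k \<ge> J")
      case True
      have "norm (q (Suc k) z) \<le> r * norm (q k z)"
        using step[OF that True] .
      also have "\<dots> \<le> r * ((\<Sum>j\<le>J. \<bar>K j\<bar>) * r ^ k)"
        using Suc \<open>r > 1\<close> by (intro mult_left_mono) auto
      finally show ?thesis by (simp add: mult_ac)
    next
      case False
      have "norm (q (Suc k) z) \<le> \<bar>K (Suc k)\<bar>"
        using K[OF that, of "Suc k"] by linarith
      also have "\<dots> \<le> (\<Sum>j\<le>J. \<bar>K j\<bar>) * 1"
        using False by (simp, intro member_le_sum) auto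
      also have "\<dots> \<le> (\<Sum>j\<le>J. \<bar>K j\<bar>) * r ^ Suc k"
        using \<open>r > 1\<close> by (intro mult_left_mono one_le_power sum_nonneg) auto
      finally show ?thesis .
    qed
  qed
  show ?thesis
    by (rule exI[of _ "\<Sum>j\<le>J. \<bar>K j\<bar>"]) (use bound in \<open>auto simp: q_def sum_nonneg\<close>)
qed


lemma ex_greater_one_mult_less_one:
  fixes u v :: real
  assumes "0 \<le> u" "u < 1" "0 \<le> v" "v < 1"
  shows "\<exists>r>1. r * u < 1 \<and> r * v < 1"
proof (intro exI conjI)
  \<comment> \<open>The reciprocal of the midpoint between \<open>max u v\<close> and 1.\<close>
  show "1 < 2 / (1 + max u v)" "2 / (1 + max u v) * u < 1" "2 / (1 + max u v) * v < 1"
    using assms by (auto simp: field_simps max_def)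
qed

text \<open>The double series is dominated by a product of two convergent binomial series: the
  growth \<open>r ^ (m + n)\<close> of the Pochhammer quotient is split between the factors, where
  \<open>r * norm x\<close> and \<open>r * norm y\<close> stay below 1.\<close>

lemma appell_F1_sums:
  assumes \<gamma>: "\<gamma> \<notin> \<int>\<^sub>\<le>\<^sub>0" and xy: "norm x < 1" "norm y < 1"
  shows "(\<lambda>k. pochhammer \<alpha> k / pochhammer \<gamma> k * binomial_diag \<beta>\<^sub>1 \<beta>\<^sub>2 x y k) sums
           appell_F1 \<alpha> \<beta>\<^sub>1 \<beta>\<^sub>2 \<gamma> x y"
proof -
  define B where "B = max (norm \<beta>\<^sub>1) (norm \<beta>\<^sub>2)"
  obtain r where r: "r > 1" "r * norm x < 1" "r * norm y < 1"
    using ex_greater_one_mult_less_one xy by (metis norm_ge_zero)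
  obtain K where K: "K \<ge> 0" "\<And>k. norm (pochhammer \<alpha> k / pochhammer \<gamma> k) \<le> K * r ^ k"
    \<comment> \<open>Fixed parameters are constant functions on a one-point compact set.\<close>
    using pochhammer_quotient_bound[of "{0::nat}" "\<lambda>_. \<alpha>" "\<lambda>_. \<gamma>" r] \<gamma> r(1)
    by (auto simp: finite_imp_compact)
  define c where "c = (\<lambda>\<beta> (z::complex) n. pochhammer \<beta> n / fact n * z ^ n)"
  define C where "C = (\<lambda>(z::complex) n. pochhammer B n / fact n * (r * norm z) ^ n)"
  define f where "f = (\<lambda>(m, n). pochhammer \<alpha> (m + n) / pochhammer \<gamma> (m + n) * (c \<beta>\<^sub>1 x m * c \<beta>\<^sub>2 y n))"
  have "B \<ge> 0"
    by (simp add: B_def le_max_iff_disj)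
  then have C_nonneg: "C z n \<ge> 0" for z :: complex and n
    using r(1) by (auto simp: C_def pochhammer_prod intro!: mult_nonneg_nonneg divide_nonneg_nonneg prod_nonneg)
  have C_summable: "C z summable_on UNIV" if "r * norm z < 1" for z :: complex
    using pochhammer_sums_powr[of "r * norm z" B] that C_nonneg r(1)
    by (subst summable_on_UNIV_nonneg_real_iff) (auto simp: C_def sums_iff)
  have bound: "r ^ n * norm (c \<beta> z n) \<le> C z n" if "norm \<beta> \<le> B" for \<beta> z n
  proof -
    have "r ^ n * norm (c \<beta> z n) = norm (pochhammer \<beta> n) / fact n * (r * norm z) ^ n"
      using r(1) by (simp add: c_def norm_mult norm_divide norm_power power_mult_distrib)
    also have "\<dots> \<le> C z n"
      unfolding C_def using r(1) by (intro mult_right_mono divide_right_mono norm_pochhammer_le[OF that]) auto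
    finally show ?thesis .
  qed
  have "(\<lambda>(m, n). C x m * C y n) summable_on UNIV \<times> UNIV"
    using C_summable[OF r(2)] C_summable[OF r(3)] C_nonneg
    by (intro summable_on_SigmaI[where g = "\<lambda>m. C x m * infsum (C y) UNIV"])
       (auto intro!: has_sum_cmult_right summable_on_cmult_left mult_nonneg_nonneg)
  then have "(\<lambda>p. K * (case p of (m, n) \<Rightarrow> C x m * C y n)) summable_on UNIV"
    by (intro summable_on_cmult_right) simp
  then have "f summable_on UNIV"
  proof (rule abs_summable_summable[OF summable_on_comparison_test])
    fix p :: "nat \<times> nat"
    obtain m n where p: "p = (m, n)" by force
    have "norm (f p) = norm (pochhammer \<alpha> (m + n) / pochhammer \<gamma> (m + n)) * (norm (c \<beta>\<^sub>1 x m) * norm (c \<beta>\<^sub>2 y n))"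
      by (simp add: f_def p norm_mult norm_divide)
    also have "\<dots> \<le> K * r ^ (m + n) * (norm (c \<beta>\<^sub>1 x m) * norm (c \<beta>\<^sub>2 y n))"
      by (intro mult_right_mono K) auto
    also have "\<dots> = K * ((r ^ m * norm (c \<beta>\<^sub>1 x m)) * (r ^ n * norm (c \<beta>\<^sub>2 y n)))"
      by (simp add: power_add mult_ac)
    also have "\<dots> \<le> K * (C x m * C y n)"
      using r(1) K(1) C_nonneg by (intro mult_left_mono mult_mono bound) (auto simp: B_def)
    finally show "norm (f p) \<le> K * (case p of (m, n) \<Rightarrow> C x m * C y n)"
      by (simp add: p)
  qed auto
  moreover have "appell_F1 \<alpha> \<beta>\<^sub>1 \<beta>\<^sub>2 \<gamma> x y = infsum f UNIV"
    unfolding appell_F1_def f_def c_def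
    by (intro infsum_cong) (auto simp: pochhammer_fact mult_ac)
  ultimately have "appell_F1 \<alpha> \<beta>\<^sub>1 \<beta>\<^sub>2 \<gamma> x y = (\<Sum>k. \<Sum>i\<le>k. f (i, k - i)) \<and> summable (\<lambda>k. \<Sum>i\<le>k. f (i, k - i))"
    using antidiagonal_sums[of f] by (simp add: sums_iff)
  moreover have "(\<Sum>i\<le>k. f (i, k - i)) = pochhammer \<alpha> k / pochhammer \<gamma> k * binomial_diag \<beta>\<^sub>1 \<beta>\<^sub>2 x y k" for k
    by (simp add: f_def c_def binomial_diag_def sum_distrib_left)
  ultimately show ?thesis
    by (simp add: sums_iff)
qed

text \<open>The partial sums of the antidiagonal series are holomorphic and converge uniformly on
  closed discs in \<open>S\<close>, by a majorant with scaled arguments \<open>r * norm x\<close>,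
  \<open>r * norm y\<close>.\<close>

lemma appell_F1_holomorphic:
  fixes \<alpha> \<beta>\<^sub>1 \<beta>\<^sub>2 \<gamma> :: "complex \<Rightarrow> complex"
  assumes S: "open S"
    and hol: "\<alpha> holomorphic_on S" "\<beta>\<^sub>1 holomorphic_on S" "\<beta>\<^sub>2 holomorphic_on S" "\<gamma> holomorphic_on S"
    and \<gamma>: "\<And>z. z \<in> S \<Longrightarrow> \<gamma> z \<notin> \<int>\<^sub>\<le>\<^sub>0" and xy: "norm x < 1" "norm y < 1"
  shows "(\<lambda>z. appell_F1 (\<alpha> z) (\<beta>\<^sub>1 z) (\<beta>\<^sub>2 z) (\<gamma> z) x y) holomorphic_on S"
proof -
  define T where "T = (\<lambda>k z. pochhammer (\<alpha> z) k / pochhammer (\<gamma> z) k * binomial_diag (\<beta>\<^sub>1 z) (\<beta>\<^sub>2 z) x y k)"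
  obtain r where r: "r > 1" "r * norm x < 1" "r * norm y < 1"
    using ex_greater_one_mult_less_one xy by (metis norm_ge_zero)
  show ?thesis
  proof (rule holomorphic_uniform_sequence[OF S, where f = "\<lambda>n z. \<Sum>k<n. T k z"])
    fix n
    show "(\<lambda>z. \<Sum>k<n. T k z) holomorphic_on S"
      unfolding T_def binomial_diag_def pochhammer_prod using \<gamma>
      by (intro holomorphic_intros hol)
         (auto dest: plus_of_nat_eq_0_imp)
  next
    fix z0 assume "z0 \<in> S"
    then obtain d where d: "d > 0" "cball z0 d \<subseteq> S"
      using S open_contains_cball by blast
    have cont: "continuous_on (cball z0 d) g" if "g holomorphic_on S" for g :: "complex \<Rightarrow> complex"
      using that d(2) holomorphic_on_imp_continuous_on holomorphic_on_subset by blast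
    obtain K where K: "K \<ge> 0"
      "\<And>z k. z \<in> cball z0 d \<Longrightarrow> norm (pochhammer (\<alpha> z) k / pochhammer (\<gamma> z) k) \<le> K * r ^ k"
      using pochhammer_quotient_bound[of "cball z0 d" \<alpha> \<gamma> r] \<gamma> r(1) cont hol d
      by (metis compact_cball subsetD)
    have bdd: "\<exists>B. \<forall>z\<in>cball z0 d. norm (g z) \<le> B" if "g holomorphic_on S" for g :: "complex \<Rightarrow> complex"
      using compact_imp_bounded[OF compact_continuous_image[OF cont[OF that]]]
      by (auto simp: bounded_iff)
    obtain B1 B2 where B12: "\<And>z. z \<in> cball z0 d \<Longrightarrow> norm (\<beta>\<^sub>1 z) \<le> B1" "\<And>z. z \<in> cball z0 d \<Longrightarrow> norm (\<beta>\<^sub>2 z) \<le> B2"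
      using bdd hol by meson
    define B where "B = max B1 B2"
    have "uniform_limit (cball z0 d) (\<lambda>n z. \<Sum>k<n. T k z) (\<lambda>z. \<Sum>k. T k z) sequentially"
    proof (rule Weierstrass_m_test)
      show "summable (\<lambda>k. K * binomial_diag B B (r * norm x) (r * norm y) k)"
        using binomial_diag_sums[of "r * norm x" "r * norm y" B B] r
        by (intro summable_mult) (auto simp: sums_iff)
    next
      fix k z assume z: "z \<in> cball z0 d"
      have "norm (T k z) \<le> K * r ^ k * binomial_diag B B (norm x) (norm y) k"
        unfolding T_def norm_mult using K(1) r(1) B12[OF z]
        by (intro mult_mono K(2)[OF z] norm_binomial_diag_le) (auto simp: B_def)
      then show "norm (T k z) \<le> K * binomial_diag B B (r * norm x) (r * norm y) k"
        by (simp add: binomial_diag_scale mult_ac)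
    qed
    also have "?this \<longleftrightarrow> uniform_limit (cball z0 d) (\<lambda>n z. \<Sum>k<n. T k z)
                 (\<lambda>z. appell_F1 (\<alpha> z) (\<beta>\<^sub>1 z) (\<beta>\<^sub>2 z) (\<gamma> z) x y) sequentially"
      using d(2) \<gamma> appell_F1_sums[OF _ xy] unfolding T_def
      by (intro uniform_limit_cong') (auto simp: sums_iff)
    finally show "\<exists>d>0. cball z0 d \<subseteq> S \<and> uniform_limit (cball z0 d) (\<lambda>n z. \<Sum>k<n. T k z)
                 (\<lambda>z. appell_F1 (\<alpha> z) (\<beta>\<^sub>1 z) (\<beta>\<^sub>2 z) (\<gamma> z) x y) sequentially"
      using d by blast
  qed
qed


section \<open>Euler's integral with parameter difference 1/2\<close>

text \<open>Integrating the \<open>k\<close>-th power of the variable against the Beta weight thus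
  produces the Pochhammer quotient of the series.\<close>

lemma Beta_shift_left:
  fixes p q :: real
  assumes "p > 0" "q > 0"
  shows "Beta (p + of_nat k) q = Beta p q * (pochhammer p k / pochhammer (p + q) k)"
proof -
  have "p \<notin> \<int>\<^sub>\<le>\<^sub>0" "p + q \<notin> \<int>\<^sub>\<le>\<^sub>0"
    using assms by (auto elim!: nonpos_Ints_cases)
  moreover from this have "Gamma p \<noteq> 0" "Gamma (p + q) \<noteq> 0"
    by (simp_all add: Gamma_eq_zero_iff)
  ultimately show ?thesis
    by (simp add: Beta_def pochhammer_Gamma add_ac)
qed

text \<open>The substitution \<open>t = 1 - s\<^sup>2\<close> removes the singularity of the Beta integral at \<open>t = 1\<close>.\<close>

lemma has_integral_Beta_half:
  fixes p :: real
  assumes "p > 1"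
  shows "((\<lambda>s. (1 - s\<^sup>2) powr (p - 1)) has_integral Beta p (1/2) / 2) {0..1}"
proof -
  define f :: "real \<Rightarrow> real" where "f s = (1 - s\<^sup>2) powr (p - 1)" for s
  have cont: "continuous_on {0..1} f"
    unfolding f_def using assms
    by (intro continuous_on_powr' continuous_intros) (auto simp: abs_square_le_1)
  \<comment> \<open>The substitution is decreasing, so the first integral runs over an empty
    interval and vanishes. The point \<open>t = 1\<close>, where the square root is not
    differentiable, is excepted by \<open>s = {1}\<close>.\<close>
  have "((\<lambda>t. (- inverse (sqrt (1 - t)) / 2) *\<^sub>R f (sqrt (1 - t))) has_integral
          (integral {sqrt (1 - 0)..sqrt (1 - 1)} f - integral {sqrt (1 - 1)..sqrt (1 - 0)} f)) {0..1}"
    by (rule has_integral_substitution_general[where s = "{1}" and c = 0 and d = 1 and g = "\<lambda>t. sqrt (1 - t)"])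
       (use cont in \<open>auto intro!: continuous_intros derivative_eq_intros simp: field_simps\<close>)
  then have "((\<lambda>t. (- 2) * ((- inverse (sqrt (1 - t)) / 2) *\<^sub>R f (sqrt (1 - t)))) has_integral
          (- 2) * (- integral {0..1} f)) {0..1}"
    by (intro has_integral_mult_right) simp
  \<comment> \<open>At \<open>t = 1\<close> both sides are 0, by \<open>inverse 0 = 0\<close> and
    \<open>0 powr x = 0\<close>.\<close>
  moreover have "(- 2) * ((- inverse (sqrt (1 - t)) / 2) *\<^sub>R f (sqrt (1 - t))) =
                   t powr (p - 1) * (1 - t) powr (1/2 - 1)" if "t \<in> {0..1}" for t
    using that by (cases "t = 1") (auto simp: f_def powr_minus powr_half_sqrt)
  ultimately have "((\<lambda>t. t powr (p - 1) * (1 - t) powr (1/2 - 1)) has_integral 2 * integral {0..1} f) {0..1}"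
    by (subst has_integral_cong[symmetric]) auto
  moreover have "((\<lambda>t. t powr (p - 1) * (1 - t) powr (1/2 - 1)) has_integral Beta p (1/2)) {0..1}"
    by (rule has_integral_Beta_real) (use assms in auto)
  ultimately have "2 * integral {0..1} f = Beta p (1/2)"
    by (rule has_integral_unique)
  then have int_f: "integral {0..1} f = Beta p (1/2) / 2"
    by simp
  have "(f has_integral Beta p (1/2) / 2) {0..1}"
    using integrable_integral[OF integrable_continuous_real[OF cont]] unfolding int_f .
  then show ?thesis
    unfolding f_def[abs_def] .
qed

text \<open>Expanding the two binomial factors in powers of \<open>t = 1 - s\<^sup>2\<close> and
  integrating termwise gives a Beta value for each power. The series converges uniformly on
  \<open>{0..1}\<close> because \<bar>x\<bar> and \<bar>y\<bar> are below 1.\<close>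

lemma appell_F1_eq_integral:
  fixes p \<beta>\<^sub>1 \<beta>\<^sub>2 x y :: real
  assumes p: "p > 1" and xy: "\<bar>x\<bar> < 1" "\<bar>y\<bar> < 1"
    and I: "((\<lambda>s. (1 - s\<^sup>2) powr (p - 1) *
               ((1 - x * (1 - s\<^sup>2)) powr (- \<beta>\<^sub>1) * (1 - y * (1 - s\<^sup>2)) powr (- \<beta>\<^sub>2))) has_integral I) {0..1}"
  shows "appell_F1 (of_real p) (of_real \<beta>\<^sub>1) (of_real \<beta>\<^sub>2) (of_real p + 1/2) (of_real x) (of_real y) =
           of_real (2 * I / Beta p (1/2))"
proof -
  define e where "e = binomial_diag \<beta>\<^sub>1 \<beta>\<^sub>2 x y"
  define B where "B = max \<bar>\<beta>\<^sub>1\<bar> \<bar>\<beta>\<^sub>2\<bar>"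
  define M where "M = Beta p (1/2) / 2"
  \<comment> \<open>A single exponent lets \<open>has_integral_Beta_half\<close> apply with
    \<open>p + real k\<close>; \<open>h_eq\<close> supplies the factored form used for
    summation.\<close>
  define h where "h = (\<lambda>k s. e k * (1 - s\<^sup>2) powr (p + real k - 1))"
  have u: "0 \<le> 1 - s\<^sup>2 \<and> 1 - s\<^sup>2 \<le> 1" if "s \<in> {0..1}" for s :: real
    using that by (auto simp: abs_square_le_1)
  have M_nz: "M \<noteq> 0"
    using p by (simp add: M_def Beta_def Gamma_eq_zero_iff) (auto elim!: nonpos_Ints_cases)
  have h_eq: "h k s = (1 - s\<^sup>2) powr (p - 1) * binomial_diag \<beta>\<^sub>1 \<beta>\<^sub>2 ((1 - s\<^sup>2) * x) ((1 - s\<^sup>2) * y) k"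
    if "s \<in> {0..1}" for k s
  proof -
    have "(1 - s\<^sup>2) powr (p + real k - 1) = (1 - s\<^sup>2) powr (p - 1) * (1 - s\<^sup>2) ^ k"
      using u[OF that] powr_add[of "1 - s\<^sup>2" "p - 1" "real k"] powr_realpow[of "1 - s\<^sup>2" k]
      by (cases "1 - s\<^sup>2 = 0") (auto simp: algebra_simps)
    then show ?thesis
      by (simp add: h_def e_def binomial_diag_scale)
  qed
  have u_abs: "\<bar>(1 - s\<^sup>2) * z\<bar> < 1" if "s \<in> {0..1}" "\<bar>z\<bar> < 1" for s z :: real
    using u[OF that(1)] that(2) mult_left_le_one_le[of "\<bar>z\<bar>" "1 - s\<^sup>2"] by (auto simp: abs_mult)
  have suminf_h: "(\<Sum>k. h k s) = (1 - s\<^sup>2) powr (p - 1) *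
               ((1 - x * (1 - s\<^sup>2)) powr (- \<beta>\<^sub>1) * (1 - y * (1 - s\<^sup>2)) powr (- \<beta>\<^sub>2))" if "s \<in> {0..1}" for s
    using sums_mult[OF binomial_diag_sums[OF u_abs u_abs, OF that xy(1) that xy(2)]] h_eq[OF that]
    by (simp add: sums_iff mult.commute)
  have unif: "uniform_limit {0..1} (\<lambda>n s. \<Sum>k<n. h k s) (\<lambda>s. \<Sum>k. h k s) sequentially"
  proof (rule Weierstrass_m_test)
    show "summable (binomial_diag B B \<bar>x\<bar> \<bar>y\<bar>)"
      using binomial_diag_sums[of "\<bar>x\<bar>" "\<bar>y\<bar>" B B] xy by (auto simp: sums_iff)
    fix k and s :: real assume s: "s \<in> {0..1}"
    have "\<bar>h k s\<bar> \<le> \<bar>e k\<bar> * 1"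
      unfolding h_def abs_mult using u[OF s] p by (intro mult_left_mono) (auto intro!: powr_le1)
    also have "\<dots> \<le> binomial_diag B B \<bar>x\<bar> \<bar>y\<bar> k"
      using norm_binomial_diag_le[of \<beta>\<^sub>1 B \<beta>\<^sub>2 x y k] by (simp add: e_def B_def)
    finally show "norm (h k s) \<le> binomial_diag B B \<bar>x\<bar> \<bar>y\<bar> k" by simp
  qed
  have cont: "continuous_on {0..1} (\<lambda>s. \<Sum>k<n. h k s)" for n
    unfolding h_def using p
    by (intro continuous_intros continuous_on_powr') (auto simp: abs_square_le_1)
  obtain I' J where I': "\<And>n. ((\<lambda>s. \<Sum>k<n. h k s) has_integral I' n) {0..1}"
      and J: "((\<lambda>s. \<Sum>k. h k s) has_integral J) {0..1}" and lim: "I' \<longlonglongrightarrow> J"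
    by (rule uniform_limit_integral[OF unif cont]) auto
  have "(h k has_integral e k * (M * (pochhammer p k / pochhammer (p + 1/2) k))) {0..1}" for k
    using has_integral_mult_right[OF has_integral_Beta_half[of "p + real k"], of "e k"] p
    by (simp add: h_def M_def Beta_shift_left mult_ac)
  then have "((\<lambda>s. \<Sum>k<n. h k s) has_integral (\<Sum>k<n. e k * (M * (pochhammer p k / pochhammer (p + 1/2) k)))) {0..1}" for n
    by (intro has_integral_sum) auto
  then have I'_eq: "I' n = (\<Sum>k<n. e k * (M * (pochhammer p k / pochhammer (p + 1/2) k)))" for n
    using I' has_integral_unique by blast
  have J_eq: "J = I"
  proof (rule has_integral_unique)
    show "((\<lambda>s. \<Sum>k. h k s) has_integral I) {0..1}"
      using I by (subst has_integral_cong[OF suminf_h])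
  qed (fact J)
  have "(\<lambda>k. e k * (M * (pochhammer p k / pochhammer (p + 1/2) k))) sums I"
    using lim unfolding sums_def I'_eq J_eq .
  then have "(\<lambda>k. 1 / M * (e k * (M * (pochhammer p k / pochhammer (p + 1/2) k)))) sums (1 / M * I)"
    by (rule sums_mult)
  then have "(\<lambda>k. pochhammer p k / pochhammer (p + 1/2) k * e k) sums (I / M)"
    using M_nz by (simp add: mult_ac)
  then have "(\<lambda>k. of_real (pochhammer p k / pochhammer (p + 1/2) k * e k)) sums complex_of_real (I / M)"
    by (rule sums_of_real)
  moreover have "complex_of_real (pochhammer p k / pochhammer (p + 1/2) k * e k) =
      pochhammer (of_real p) k / pochhammer (of_real p + 1/2) k *
      binomial_diag (of_real \<beta>\<^sub>1) (of_real \<beta>\<^sub>2) (of_real x) (of_real y) k" for k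
    using pochhammer_of_real[of "p + 1/2" k, where 'a = complex]
    by (simp add: e_def binomial_diag_def pochhammer_of_real)
  moreover have "complex_of_real p + 1/2 \<notin> \<int>\<^sub>\<le>\<^sub>0"
    using p by (auto elim!: nonpos_Ints_cases simp: complex_eq_iff)
  ultimately show ?thesis
    using appell_F1_sums[of "of_real p + 1/2" "of_real x" "of_real y" "of_real p" "of_real \<beta>\<^sub>1" "of_real \<beta>\<^sub>2"] xy
    by (simp add: sums_iff M_def)
qed


section \<open>The pullback along a rational map of degree five\<close>

text \<open>The integrand is \<open>u\<close> to the power \<open>a\<close> times a factor independent of \<open>a\<close>, where
  \<open>u = t\<^sup>2 (1 + t/80)\<^sup>3 / (1 - 5t/32)\<^sup>4\<close> and \<open>t = 1 - s\<^sup>2\<close>. Since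
  \<open>256 (1 - 5t/32)\<^sup>4 - 125 t\<^sup>2 (1 + t/80)\<^sup>3 = 256 (1 - t) (1 + 3t/16 - t\<^sup>2/1024)\<^sup>2\<close>,
  the function \<open>1 - 125 u / 256\<close> of \<open>s\<close> is the square of the rational function \<open>w\<close> below.\<close>

lemma has_integral_quintic_pullback:
  fixes a :: real
  assumes a: "a > 1"
  shows "((\<lambda>s. (1 - s\<^sup>2) powr (2 * a - 1) *
            ((1 - (- 1/80) * (1 - s\<^sup>2)) powr (- (1 - 3 * a)) * (1 - 5/32 * (1 - s\<^sup>2)) powr (- (4 * a - 1))))
          has_integral (256 / 125) powr a * Beta a (1/2) / 4) {0..1}"
proof -
  define t P Q :: "real \<Rightarrow> real"
    where "t s = 1 - s\<^sup>2" and "P s = 1 + (1 - s\<^sup>2) / 80" and "Q s = 1 - 5 * (1 - s\<^sup>2) / 32" for s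
  define w where "w s = s * (1 + 3 * t s / 16 - (t s)\<^sup>2 / 1024) / (Q s)\<^sup>2" for s
  \<comment> \<open>This is the derivative of \<open>w\<close>, in factored form. A zero of
    \<open>1 - w\<^sup>2\<close> of order \<open>m\<close> is a zero of \<open>w'\<close> of order
    \<open>m - 1\<close>, whence \<open>t * P\<^sup>2\<close>; the double poles of \<open>w\<close>
    at the zeros of \<open>Q\<close> give \<open>Q ^ 3\<close>.\<close>
  define w' where "w' s = 125/128 * t s * (P s)\<^sup>2 / Q s ^ 3" for s
  \<comment> \<open>With \<open>w = sqrt (1 - v)\<close> the differential
    \<open>dv / (2 v sqrt (1 - v))\<close> becomes \<open>- dw / (1 - w\<^sup>2)\<close>. The bound
    variable here is this \<open>w\<close>.\<close>
  define f :: "real \<Rightarrow> real" where "f = (\<lambda>v. (1 - v\<^sup>2) powr (a - 1))"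
  have Q_pos: "Q s > 0" for s
  proof -
    have "Q s = (27 + 5 * s\<^sup>2) / 32" by (simp add: Q_def field_simps)
    then show ?thesis by (simp only:) (simp add: add_pos_nonneg)
  qed
  have P_pos: "P s > 0" if "s \<in> {0..1}" for s
    using that abs_square_le_1[of s] by (simp add: P_def add_pos_nonneg)
  have w_sq: "1 - (w s)\<^sup>2 = 125/256 * (t s)\<^sup>2 * P s ^ 3 / Q s ^ 4" for s
  proof -
    define N where "N = s * (1 + 3 * t s / 16 - (t s)\<^sup>2 / 1024)"
    have "Q s ^ 4 - N\<^sup>2 = 125/256 * (t s)\<^sup>2 * P s ^ 3"
      by (simp add: N_def Q_def P_def t_def field_simps power2_eq_square power3_eq_cube power4_eq_xxxx)
    moreover have "1 - (w s)\<^sup>2 = (Q s ^ 4 - N\<^sup>2) / Q s ^ 4"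
      using Q_pos[of s] by (simp add: w_def N_def power_divide diff_divide_distrib flip: power_mult)
    ultimately show ?thesis
      by (simp only:)
  qed
  have deriv: "(w has_field_derivative w' s) (at s within {0..1})" for s
  proof -
    have "((\<lambda>s. s * (1 + 3 * (1 - s\<^sup>2) / 16 - (1 - s\<^sup>2)\<^sup>2 / 1024)) has_field_derivative
            (1 + 3 * (1 - s\<^sup>2) / 16 - (1 - s\<^sup>2)\<^sup>2 / 1024) + s * (- 6 * s / 16 + 4 * s * (1 - s\<^sup>2) / 1024)) (at s within {0..1})"
      by (auto intro!: derivative_eq_intros simp: field_simps power2_eq_square)
    moreover have "((\<lambda>s. (Q s)\<^sup>2) has_field_derivative 2 * Q s * (10 * s / 32)) (at s within {0..1})"
      unfolding Q_def by (auto intro!: derivative_eq_intros simp: field_simps power2_eq_square)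
    ultimately have "(w has_field_derivative
        (((1 + 3 * (1 - s\<^sup>2) / 16 - (1 - s\<^sup>2)\<^sup>2 / 1024) + s * (- 6 * s / 16 + 4 * s * (1 - s\<^sup>2) / 1024)) * (Q s)\<^sup>2 -
         s * (1 + 3 * (1 - s\<^sup>2) / 16 - (1 - s\<^sup>2)\<^sup>2 / 1024) * (2 * Q s * (10 * s / 32))) / ((Q s)\<^sup>2 * (Q s)\<^sup>2)) (at s within {0..1})"
      unfolding w_def[abs_def] t_def using Q_pos[of s] by (intro DERIV_divide) auto
    also have "(((1 + 3 * (1 - s\<^sup>2) / 16 - (1 - s\<^sup>2)\<^sup>2 / 1024) + s * (- 6 * s / 16 + 4 * s * (1 - s\<^sup>2) / 1024)) * (Q s)\<^sup>2 -
         s * (1 + 3 * (1 - s\<^sup>2) / 16 - (1 - s\<^sup>2)\<^sup>2 / 1024) * (2 * Q s * (10 * s / 32))) =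
         125/128 * t s * (P s)\<^sup>2 * Q s"
      by (simp add: Q_def P_def t_def field_simps power2_eq_square)
    also have "125/128 * t s * (P s)\<^sup>2 * Q s / ((Q s)\<^sup>2 * (Q s)\<^sup>2) = w' s"
      using Q_pos[of s] by (simp add: w'_def power2_eq_square power3_eq_cube)
    finally show ?thesis .
  qed
  have w_range: "w s \<in> {0..1}" if "s \<in> {0..1}" for s
  proof -
    have "t s \<in> {0..1}"
      using that by (auto simp: t_def abs_square_le_1)
    then have "(t s)\<^sup>2 \<le> 1" "0 \<le> t s"
      by (auto simp: abs_square_le_1)
    then have "0 \<le> w s"
      using that Q_pos[of s] unfolding w_def by (intro divide_nonneg_pos mult_nonneg_nonneg) auto
    moreover have "0 \<le> 1 - (w s)\<^sup>2"
      unfolding w_sq using P_pos[OF that] Q_pos[of s] by simp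
    ultimately show ?thesis
      by (auto simp: abs_square_le_1)
  qed
  have w01: "w 0 = 0" "w 1 = 1"
    by (simp_all add: w_def t_def Q_def)
  have "((\<lambda>s. w' s *\<^sub>R f (w s)) has_integral integral {w 0..w 1} f) {0..1}"
  proof (rule has_integral_substitution[where c = 0 and d = 1])
    show "continuous_on {0..1} f"
      unfolding f_def using a by (intro continuous_on_powr' continuous_intros) (auto simp: abs_square_le_1)
  qed (use w_range deriv w01 in auto)
  moreover have "integral {0..1} f = Beta a (1/2) / 2"
    using has_integral_Beta_half[OF a] unfolding f_def by (rule integral_unique)
  ultimately have "((\<lambda>s. w' s * f (w s)) has_integral Beta a (1/2) / 2) {0..1}"
    by (simp add: w01)
  \<comment> \<open>Since \<open>w' / (1 - w\<^sup>2) = 2 * Q / (t * P)\<close>, the factor 1/2 is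
    needed, and \<open>(256/125) powr a\<close> turns the power of \<open>v = 1 - w\<^sup>2\<close>
    into that of \<open>u\<close>.\<close>
  then have "((\<lambda>s. (256/125) powr a / 2 * (w' s * f (w s))) has_integral (256/125) powr a / 2 * (Beta a (1/2) / 2)) {0..1}"
    by (rule has_integral_mult_right)
  moreover have "(256/125) powr a / 2 * (w' s * f (w s)) =
      t s powr (2 * a - 1) * (P s powr (- (1 - 3 * a)) * Q s powr (- (4 * a - 1)))" if s: "s \<in> {0..1}" for s
  \<comment> \<open>At \<open>s = 1\<close> both sides vanish with \<open>t\<close>. Elsewhere
    \<open>t\<close>, \<open>P\<close>, \<open>Q\<close> are positive, and the exponents are
    compared through their logarithms.\<close>
  proof (cases "s = 1")
    case True
    then show ?thesis by (simp add: w'_def t_def)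
  next
    case False
    then have t: "t s > 0"
      using s by (simp add: t_def power_less_one_iff abs_square_less_1)
    note pos = t P_pos[OF s] Q_pos[of s]
    have w'_exp: "w' s = exp (ln (125/256) + ln 2 + ln (t s) + 2 * ln (P s) - 3 * ln (Q s))"
      using pos by (simp add: w'_def exp_add exp_diff exp_of_nat_mult[of 2, simplified] exp_of_nat_mult[of 3, simplified])
    have "1 - (w s)\<^sup>2 = exp (ln (125/256) + 2 * ln (t s) + 3 * ln (P s) - 4 * ln (Q s))"
      using pos by (simp add: w_sq exp_add exp_diff exp_of_nat_mult[of 2, simplified]
          exp_of_nat_mult[of 3, simplified] exp_of_nat_mult[of 4, simplified])
    then have f_exp: "f (w s) = exp ((a - 1) * (ln (125/256) + 2 * ln (t s) + 3 * ln (P s) - 4 * ln (Q s)))"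
      by (simp only: f_def powr_def exp_not_eq_zero if_False ln_exp)
    have "ln (256/125 :: real) = - ln (125/256)"
      by (simp add: ln_div)
    then have c: "(256/125::real) powr a / 2 = exp (- a * ln (125/256) - ln 2)"
      by (simp add: powr_def exp_diff)
    show ?thesis
      unfolding w'_exp f_exp c using pos
      by (simp add: powr_def algebra_simps flip: exp_add)
  qed
  ultimately show ?thesis
    by (subst has_integral_cong[where g = "\<lambda>s. (256/125) powr a / 2 * (w' s * f (w s))"])
       (auto simp: t_def P_def Q_def)
qed


section \<open>The closed form for real parameters and its continuation\<close>

text \<open>The integral yields a quotient of Beta values. Legendre duplication eliminates
  \<open>Gamma a\<close> and \<open>Gamma (2 * a)\<close>, and its power of 2 reduces the exponent
  of 2 from \<open>8 * a\<close> to \<open>6 * a\<close>.\<close>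

lemma appell_F1_special_real:
  fixes a :: real
  assumes a: "a > 1"
  shows "appell_F1 (2 * of_real a) (1 - 3 * of_real a) (4 * of_real a - 1) (2 * of_real a + 1 / 2) (- 1 / 80) (5 / 32) =
           2 powr (6 * of_real a) / 5 powr (3 * of_real a) *
           (of_real (sqrt pi) * Gamma (2 * of_real a + 1 / 2) * rGamma (of_real a + 1 / 2) ^ 2)"
proof -
  have "appell_F1 (of_real (2 * a)) (of_real (1 - 3 * a)) (of_real (4 * a - 1)) (of_real (2 * a) + 1/2)
          (of_real (- 1/80)) (of_real (5/32)) =
        of_real (2 * ((256 / 125) powr a * Beta a (1/2) / 4) / Beta (2 * a) (1/2))"
    using a has_integral_quintic_pullback[OF a] by (intro appell_F1_eq_integral) simp_all
  also have "2 * ((256 / 125) powr a * Beta a (1/2) / 4) / Beta (2 * a) (1/2) =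
        2 powr (6 * a) / 5 powr (3 * a) * (sqrt pi * Gamma (2 * a + 1/2) * rGamma (a + 1/2) ^ 2)"
  proof -
    have pos: "Gamma a > 0" "Gamma (2 * a) > 0" "Gamma (a + 1/2) > 0" "Gamma (2 * a + 1/2) > 0"
      using a by (auto intro!: Gamma_real_pos)
    have notin: "of_real x \<notin> (\<int>\<^sub>\<le>\<^sub>0 :: complex set)" if "x > 0" for x
      using that by (auto elim!: nonpos_Ints_cases simp: complex_eq_iff)
    have "complex_of_real (Gamma a * Gamma (a + 1/2)) =
          of_real (exp ((1 - 2 * a) * ln 2) * sqrt pi * Gamma (2 * a))"
      using Gamma_legendre_duplication[of "of_real a"] notin[of a] notin[of "a + 1/2"] a
        Gamma_complex_of_real[of "a + 1/2"] Gamma_complex_of_real[of "2 * a"]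
      by (simp add: Gamma_complex_of_real flip: exp_of_real)
    then have dup: "Gamma a * Gamma (a + 1/2) = exp ((1 - 2 * a) * ln 2) * sqrt pi * Gamma (2 * a)"
      by (simp only: of_real_eq_iff)
    have "2 * ((256 / 125) powr a * Beta a (1/2) / 4) / Beta (2 * a) (1/2) =
          (256 / 125) powr a / 2 * (Gamma a * Gamma (a + 1/2)) * Gamma (2 * a + 1/2) / (Gamma (2 * a) * Gamma (a + 1/2) ^ 2)"
      using pos by (simp add: Beta_def Gamma_one_half_real field_simps power2_eq_square)
    also have "\<dots> = ((256 / 125) powr a / 2 * exp ((1 - 2 * a) * ln 2)) * (sqrt pi * Gamma (2 * a + 1/2) * rGamma (a + 1/2) ^ 2)"
      unfolding dup using pos by (simp add: rGamma_inverse_Gamma field_simps)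
    also have "(256 / 125) powr a / 2 * exp ((1 - 2 * a) * ln 2) = 2 powr (6 * a) / (5::real) powr (3 * a)"
    proof -
      have "ln (256 / 125 :: real) = 8 * ln 2 - 3 * ln 5"
        using ln_realpow[of 2 8] ln_realpow[of 5 3] by (simp add: ln_div)
      then have "(256 / 125) powr a / 2 * exp ((1 - 2 * a) * ln 2) =
          exp (a * (8 * ln 2 - 3 * ln 5) - ln 2 + (1 - 2 * a) * ln 2)"
        by (simp add: powr_def exp_diff exp_add)
      also have "a * (8 * ln 2 - 3 * ln 5) - ln 2 + (1 - 2 * a) * ln 2 = 6 * a * ln 2 - 3 * a * ln (5::real)"
        by (simp add: algebra_simps)
      also have "exp \<dots> = 2 powr (6 * a) / 5 powr (3 * a)"
        by (simp add: powr_def exp_diff)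
      finally show ?thesis .
    qed
    finally show ?thesis .
  qed
  also have "complex_of_real \<dots> = 2 powr (6 * of_real a) / 5 powr (3 * of_real a) *
           (of_real (sqrt pi) * Gamma (2 * of_real a + 1 / 2) * rGamma (of_real a + 1 / 2) ^ 2)"
    using powr_of_real[of 2 "6 * a"] powr_of_real[of 5 "3 * a"]
      Gamma_complex_of_real[of "2 * a + 1/2"] rGamma_complex_of_real[of "a + 1/2"]
    by simp
  finally show ?thesis by simp
qed

theorem mainTheorem7:
  fixes a :: complex
  assumes "2 * a + 1 / 2 \<notin> \<int>\<^sub>\<le>\<^sub>0"
  shows "appell_F1 (2 * a) (1 - 3 * a) (4 * a - 1) (2 * a + 1 / 2) (- 1 / 80) (5 / 32) =
           2 powr (6 * a) / 5 powr (3 * a) *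
           (of_real (sqrt pi) * Gamma (2 * a + 1 / 2) * rGamma (a + 1 / 2) ^ 2)"
proof -
  define F where "F z = appell_F1 (2 * z) (1 - 3 * z) (4 * z - 1) (2 * z + 1 / 2) (- 1 / 80) (5 / 32) -
           2 powr (6 * z) / 5 powr (3 * z) *
           (of_real (sqrt pi) * Gamma (2 * z + 1 / 2) * rGamma (z + 1 / 2) ^ 2)" for z
  \<comment> \<open>The excluded parameters: as an image of the nonpositive integers
    \<open>T\<close> is countable, as a preimage it is closed.\<close>
  define T :: "complex set" where "T = (\<lambda>w. (w - 1/2) / 2) ` \<int>\<^sub>\<le>\<^sub>0"
  have T_iff: "z \<in> T \<longleftrightarrow> 2 * z + 1 / 2 \<in> \<int>\<^sub>\<le>\<^sub>0" for z
  proof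
    assume "2 * z + 1 / 2 \<in> \<int>\<^sub>\<le>\<^sub>0"
    then show "z \<in> T"
      unfolding T_def by (rule image_eqI[rotated]) simp
  next
    assume "z \<in> T"
    then obtain w where w: "w \<in> \<int>\<^sub>\<le>\<^sub>0" and "z = (w - 1 / 2) / 2"
      unfolding T_def by blast
    then have "2 * z + 1 / 2 = w"
      by (simp add: field_simps)
    with w show "2 * z + 1 / 2 \<in> \<int>\<^sub>\<le>\<^sub>0"
      by (simp only:)
  qed
  have "closed ((\<lambda>z::complex. 2 * z + 1 / 2) -` \<int>\<^sub>\<le>\<^sub>0)"
    by (intro closed_vimage closed_nonpos_Ints continuous_intros)
  also have "(\<lambda>z. 2 * z + 1 / 2) -` \<int>\<^sub>\<le>\<^sub>0 = T"
    using T_iff by blast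
  finally have op: "open (UNIV - T)"
    by (simp add: open_Diff)
  have "countable T"
    unfolding T_def by (intro countable_image countable_subset[OF nonpos_Ints_subset_Ints countable_int])
  then have conn: "connected (UNIV - T)"
    by (intro connected_open_diff_countable) auto
  \<comment> \<open>Off \<open>T\<close> the factor \<open>Gamma (2 * z + 1 / 2)\<close> has no
    pole, and \<open>rGamma\<close> is entire.\<close>
  have hol: "F holomorphic_on UNIV - T"
    unfolding F_def using T_iff op
    by (intro holomorphic_intros appell_F1_holomorphic) auto
  have zero: "F (of_real x) = 0" if "x > 1" for x
    using appell_F1_special_real[OF that] by (simp add: F_def)
  have real_notin: "of_real x \<in> UNIV - T" if "x > 1" for x
    using that unfolding Diff_iff T_iff
    by (auto elim!: nonpos_Ints_cases simp: complex_eq_iff)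
  \<comment> \<open>Any point of the real half-line where \<open>F\<close> vanishes would do; the
    points \<open>2 + e / 2\<close> accumulate at 2.\<close>
  have lim: "(of_real 2 :: complex) islimpt of_real ` {1<..}"
    unfolding islimpt_approachable
  proof (intro allI impI)
    fix e :: real assume "e > 0"
    then show "\<exists>x'\<in>of_real ` {1<..}. x' \<noteq> (of_real 2 :: complex) \<and> dist x' (of_real 2) < e"
      by (intro bexI[of _ "of_real (2 + e / 2)"]) (auto simp: dist_of_real dist_real_def simp del: of_real_add of_real_numeral)
  qed
  have "F a = 0"
    by (rule analytic_continuation[OF hol op conn _ _ lim])
       (use assms zero real_notin T_iff in auto)
  then show ?thesis
    by (simp add: F_def)
qed

end
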